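(* Let $\mathfrak{g}=\mathfrak{g}_{4.4}$ be the four-dimensional real Lie algebra with basis $\mathcal{B}=\{e_1,e_2,e_3,e_4\}$ whose nonzero Lie brackets (up to skew-symmetry) are $[e_1,e_4]=e_1$, $[e_2,e_4]=e_1+e_2$, $[e_3,e_4]=e_2+e_3$. Let $\langle\cdot,\cdot\rangle$ be a pseudo-Riemannian inner product on $\mathfrak{g}$ and let $(R_{ij})$ be the matrix of its Ricci operator $\operatorname{Ric}$ in the basis $\mathcal{B}$. If $$R_{i1}=0\ (i=2,3,4),\quad R_{32}=R_{42}=R_{43}=0,\quad R_{23}=R_{12},\quad R_{33}=R_{22}=R_{11},$$ then $\langle\cdot,\cdot\rangle$ is an algebraic Ricci soliton. Under these conditions, $\operatorname{Ric}=\eta I_4+D$ where $\eta=R_{44}$ and $$D=\begin{bmatrix}R_{11}-R_{44}&R_{12}&R_{13}&R_{14}\\0&R_{11}-R_{44}&R_{12}&R_{24}\\0&0&R_{11}-R_{44}&R_{34}\\0&0&0&0\end{bmatrix}$$ is (the matrix in the basis $\mathcal{B}$ of) a derivation of $\mathfrak{g}$.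
   Context: A pseudo-Riemannian inner product on a real Lie algebra $\mathfrak{g}$ is a nondegenerate symmetric bilinear form $\langle\cdot,\cdot\rangle$ on $\mathfrak{g}$ (of some signature $(r,s)$). Its Levi-Civita connection $\nabla$ is defined by $2\langle\nabla_uv,w\rangle=\langle[u,v],w\rangle+\langle[w,u],v\rangle+\langle[w,v],u\rangle$; its curvature is $R_{uv}=\nabla_{[u,v]}-[\nabla_u,\nabla_v]$; its Ricci curvature $\operatorname{ric}(u,v)$ is the trace of $w\mapsto R_{uw}v$; its Ricci operator $\operatorname{Ric}$ is the endomorphism of $\mathfrak{g}$ with $\langle\operatorname{Ric}(u),v\rangle=\operatorname{ric}(u,v)$. The matrix $(R_{ij})$ of $\operatorname{Ric}$ in a basis $\{e_i\}$ is given by $\operatorname{Ric}(e_j)=\sum_iR_{ij}e_i$ (the same column convention is used for $D$). A derivation is a linear map $D:\mathfrak{g}\to\mathfrak{g}$ with $D[x,y]=[D(x),y]+[x,D(y)]$ for all $x,y$. The inner product is an algebraic Ricci soliton if $\operatorname{Ric}=\eta\,\mathrm{Id}_{\mathfrak{g}}+D$ for some $\eta\in\mathbb{R}$ and some derivation $D$ of $\mathfrak{g}$. *)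

theory Defs
  imports "HOL-Analysis.Analysis"
begin

definition lie_bracket :: "(real^'n \<Rightarrow> real^'n \<Rightarrow> real^'n) \<Rightarrow> bool" where
  "lie_bracket br \<longleftrightarrow> bilinear br \<and> (\<forall>x. br x x = 0) \<and>
     (\<forall>x y z. br x (br y z) + br y (br z x) + br z (br x y) = 0)"

(* Any nondegenerate signature is allowed, definite ones included. *)
definition pseudo_riemannian :: "(real^'n \<Rightarrow> real^'n \<Rightarrow> real) \<Rightarrow> bool" where
  "pseudo_riemannian ip \<longleftrightarrow> bilinear ip \<and> (\<forall>x y. ip x y = ip y x) \<and>
     (\<forall>x. (\<forall>y. ip x y = 0) \<longrightarrow> x = 0)"

definition derivation :: "(real^'n \<Rightarrow> real^'n \<Rightarrow> real^'n) \<Rightarrow> (real^'n \<Rightarrow> real^'n) \<Rightarrow> bool" where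
  "derivation br D \<longleftrightarrow> linear D \<and> (\<forall>x y. D (br x y) = br (D x) y + br x (D y))"

(* The Levi-Civita product nabla_u v, by the Koszul formula for left-invariant fields;
   lemma levi_civita_koszul shows that the description is proper. *)
definition levi_civita ::
  "(real^'n \<Rightarrow> real^'n \<Rightarrow> real^'n) \<Rightarrow> (real^'n \<Rightarrow> real^'n \<Rightarrow> real) \<Rightarrow> real^'n \<Rightarrow> real^'n \<Rightarrow> real^'n" where
  "levi_civita br ip u v =
     (THE z. \<forall>w. 2 * ip z w = ip (br u v) w + ip (br w u) v + ip (br w v) u)"

(* Sign convention: R_uv = nabla_[u,v] - [nabla_u, nabla_v]. *)
definition curvature ::
  "(real^'n \<Rightarrow> real^'n \<Rightarrow> real^'n) \<Rightarrow> (real^'n \<Rightarrow> real^'n \<Rightarrow> real) \<Rightarrow>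
   real^'n \<Rightarrow> real^'n \<Rightarrow> real^'n \<Rightarrow> real^'n" where
  "curvature br ip u v w =
     levi_civita br ip (br u v) w
     - (levi_civita br ip u (levi_civita br ip v w) - levi_civita br ip v (levi_civita br ip u w))"

definition ricci ::
  "(real^'n \<Rightarrow> real^'n \<Rightarrow> real^'n) \<Rightarrow> (real^'n \<Rightarrow> real^'n \<Rightarrow> real) \<Rightarrow> real^'n \<Rightarrow> real^'n \<Rightarrow> real" where
  "ricci br ip u v = trace (matrix (\<lambda>w. curvature br ip u w v))"

definition ricci_operator ::
  "(real^'n \<Rightarrow> real^'n \<Rightarrow> real^'n) \<Rightarrow> (real^'n \<Rightarrow> real^'n \<Rightarrow> real) \<Rightarrow> real^'n \<Rightarrow> real^'n" where
  "ricci_operator br ip u = (THE z. \<forall>v. ip z v = ricci br ip u v)"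

definition algebraic_ricci_soliton ::
  "(real^'n \<Rightarrow> real^'n \<Rightarrow> real^'n) \<Rightarrow> (real^'n \<Rightarrow> real^'n \<Rightarrow> real) \<Rightarrow> bool" where
  "algebraic_ricci_soliton br ip \<longleftrightarrow>
     (\<exists>\<eta> D. derivation br D \<and> (\<forall>x. ricci_operator br ip x = \<eta> *\<^sub>R x + D x))"

(* The Lie algebra g_4.4 on real^4, with e_i = axis i 1. This is the bilinear skew-symmetric
   extension of [e1,e4] = e1, [e2,e4] = e1 + e2, [e3,e4] = e2 + e3; see g44_basis. *)
definition g44 :: "real^4 \<Rightarrow> real^4 \<Rightarrow> real^4" where
  "g44 x y = (x$1 * y$4 - x$4 * y$1) *\<^sub>R axis 1 1
           + (x$2 * y$4 - x$4 * y$2) *\<^sub>R (axis 1 1 + axis 2 1)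
           + (x$3 * y$4 - x$4 * y$3) *\<^sub>R (axis 2 1 + axis 3 1)"

lemma vector_4 [simp]:
  "(vector [a, b, c, d] :: 'a::zero^4) $ 1 = a"
  "(vector [a, b, c, d] :: 'a::zero^4) $ 2 = b"
  "(vector [a, b, c, d] :: 'a::zero^4) $ 3 = c"
  "(vector [a, b, c, d] :: 'a::zero^4) $ 4 = d"
  unfolding vector_def by simp_all

lemma g44_basis:
  "g44 (axis 1 1) (axis 4 1) = axis 1 1"
  "g44 (axis 2 1) (axis 4 1) = axis 1 1 + axis 2 1"
  "g44 (axis 3 1) (axis 4 1) = axis 2 1 + axis 3 1"
  "i \<noteq> 4 \<Longrightarrow> j \<noteq> 4 \<Longrightarrow> g44 (axis i 1) (axis j 1) = 0"
  by (simp_all add: g44_def axis_def vec_eq_iff)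

lemma lie_bracket_g44: "lie_bracket g44"
  unfolding lie_bracket_def bilinear_def linear_iff
  by (simp add: g44_def vec_eq_iff forall_4 axis_def algebra_simps)

lemma pseudo_riemannian_riesz:
  assumes ip: "pseudo_riemannian ip" and f: "linear f"
  shows "\<exists>!z. \<forall>w. ip z w = f w"
proof -
  have bi: "bilinear ip" and nd: "\<And>x. (\<And>y. ip x y = 0) \<Longrightarrow> x = 0"
    using ip by (auto simp: pseudo_riemannian_def)
  have ext: "(\<forall>w. g w = h w) \<longleftrightarrow> (\<forall>i. g (axis i 1) = h (axis i 1))"
    if "linear g" "linear h" for g h :: "real^'a \<Rightarrow> real"
    using linear_eq_stdbasis[OF that] by (auto simp: Basis_vec_def)
  have lin: "linear (ip z)" for z using bi by (simp add: bilinear_def)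
  define T where "T z = (\<chi> i. ip z (axis i 1))" for z
  have T: "linear T"
    using bi unfolding T_def linear_iff
    by (simp add: vec_eq_iff bilinear_ladd bilinear_lmul)
  have "inj T"
  proof (subst linear_injective_0[OF T], intro allI impI)
    fix z assume "T z = 0"
    then have "\<forall>i. ip z (axis i 1) = 0" by (simp add: T_def vec_eq_iff)
    then have "\<forall>w. ip z w = 0" using ext[OF lin linear_zero] by blast
    then show "z = 0" using nd by blast
  qed
  then have "bij T" using linear_injective_imp_surjective[OF T] by (simp add: bij_def)
  then have "\<exists>!z. T z = (\<chi> i. f (axis i 1))" by (simp add: bij_iff)
  then show ?thesis by (simp add: T_def vec_eq_iff ext[OF lin f])
qed

lemma levi_civita_koszul:
  assumes ip: "pseudo_riemannian ip" and br: "bilinear br"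
  shows "2 * ip (levi_civita br ip u v) w = ip (br u v) w + ip (br w u) v + ip (br w v) u"
proof -
  have bi: "bilinear ip" using ip by (simp add: pseudo_riemannian_def)
  define f where "f w = (ip (br u v) w + ip (br w u) v + ip (br w v) u) / 2" for w
  have "linear f"
    unfolding linear_iff f_def using bi br
    by (simp add: bilinear_ladd bilinear_lmul bilinear_radd bilinear_rmul field_simps)
  then have "\<exists>!z. \<forall>w. ip z w = f w" by (rule pseudo_riemannian_riesz[OF ip])
  moreover have "(\<forall>w. ip z w = f w) \<longleftrightarrow>
      (\<forall>w. 2 * ip z w = ip (br u v) w + ip (br w u) v + ip (br w v) u)" for z
    unfolding f_def by (simp add: field_simps)
  ultimately have "\<exists>!z. \<forall>w. 2 * ip z w = ip (br u v) w + ip (br w u) v + ip (br w v) u"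
    by simp
  from theI'[OF this] show ?thesis unfolding levi_civita_def by blast
qed

lemma bilinear_levi_civita:
  assumes ip: "pseudo_riemannian ip" and br: "bilinear br"
  shows "bilinear (levi_civita br ip)"
proof -
  have bi: "bilinear ip" using ip by (simp add: pseudo_riemannian_def)
  have eq: "x = y" if "\<And>w. 2 * ip x w = 2 * ip y w" for x y
  proof -
    have "ip (x - y) w = 0" for w using that[of w] by (simp add: bilinear_lsub[OF bi])
    then have "x - y = 0" using ip unfolding pseudo_riemannian_def by blast
    then show ?thesis by simp
  qed
  note K = levi_civita_koszul[OF ip br]
  note B = bilinear_ladd[OF bi] bilinear_lmul[OF bi] bilinear_radd[OF bi] bilinear_rmul[OF bi]
    bilinear_ladd[OF br] bilinear_lmul[OF br] bilinear_radd[OF br] bilinear_rmul[OF br]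
  have scale: "2 * ip (c *\<^sub>R x) w = c * (2 * ip x w)" for c x w by (simp add: B)
  have add: "2 * ip (x + y) w = 2 * ip x w + 2 * ip y w" for x y w by (simp add: B)
  show ?thesis
    unfolding bilinear_def linear_iff
    by (intro conjI allI; rule eq; simp only: scale add K; simp add: B algebra_simps)
qed

lemma linear_ricci:
  assumes ip: "pseudo_riemannian ip" and br: "bilinear br"
  shows "linear (ricci br ip u)"
proof -
  note L = bilinear_levi_civita[OF ip br]
  show ?thesis
    unfolding linear_iff ricci_def trace_def matrix_def curvature_def
    by (simp add: bilinear_radd[OF L] bilinear_rmul[OF L] sum.distrib[symmetric]
        sum_distrib_left algebra_simps)
qed

lemma ricci_operator_eq:
  assumes ip: "pseudo_riemannian ip" and br: "bilinear br"
  shows "ip (ricci_operator br ip u) v = ricci br ip u v"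
  using theI'[OF pseudo_riemannian_riesz[OF ip linear_ricci[OF ip br]]]
  unfolding ricci_operator_def by blast

end

theory Submission
  imports Defs
begin

text \<open>The curvature is never computed: the conditions on \<open>R\<close> make its difference
  with \<open>R$4$4\<close> times the identity equal to \<open>D\<close>, so only the derivation
  property of \<open>D\<close> matters. On the abelian ideal spanned by e1, e2, e3, bracketing with
  e4 on the right is I + N for a nilpotent Jordan block N, and \<open>D\<close> acts there as a
  polynomial in N (\<open>derivation_g44\<close>). Passing from the matrix \<open>R\<close> back to
  the Ricci operator requires its linearity (\<open>linear_ricci_operator\<close>).\<close>

lemma linear_ricci_left:
  assumes ip: "pseudo_riemannian ip" and br: "bilinear br"
  shows "linear (\<lambda>u. ricci br ip u v)"
proof -
  note L = bilinear_levi_civita[OF ip br]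
  show ?thesis
    unfolding linear_iff ricci_def trace_def matrix_def curvature_def
    by (simp add: bilinear_ladd[OF L] bilinear_lmul[OF L] bilinear_radd[OF L] bilinear_rmul[OF L]
        bilinear_ladd[OF br] bilinear_lmul[OF br] sum.distrib[symmetric]
        sum_distrib_left algebra_simps)
qed

text \<open>By nondegeneracy a vector is determined by its pairings, so linearity descends from the
  first slot of \<open>ricci\<close>.\<close>

lemma linear_ricci_operator:
  assumes ip: "pseudo_riemannian ip" and br: "bilinear br"
  shows "linear (ricci_operator br ip)"
proof -
  have bi: "bilinear ip" using ip by (simp add: pseudo_riemannian_def)
  have eq: "x = y" if "\<And>w. ip x w = ip y w" for x y
  proof -
    have "ip (x - y) w = 0" for w using that[of w] by (simp add: bilinear_lsub[OF bi])
    then have "x - y = 0" using ip unfolding pseudo_riemannian_def by blast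
    then show ?thesis by simp
  qed
  show ?thesis
    unfolding linear_iff
    by (intro conjI allI; rule eq)
      (simp_all add: bilinear_ladd[OF bi] bilinear_lmul[OF bi] ricci_operator_eq[OF ip br]
        linear_add[OF linear_ricci_left[OF ip br]] linear_cmul[OF linear_ricci_left[OF ip br]])
qed

text \<open>The zero last row puts the image of \<open>M\<close> in the ideal, so [x, M e4] = 0 for
  x in the ideal. There \<open>M\<close> is a I + b N + c N^2, which commutes with I + N; this gives
  the Leibniz rule on the pairs (x, e4). On pairs inside the ideal both sides vanish.\<close>

lemma derivation_g44:
  fixes M :: "real^4^4"
  assumes "M$2$1 = 0" "M$3$1 = 0" "M$3$2 = 0" "\<And>j. M$4$j = 0"
    and "M$2$2 = M$1$1" "M$3$3 = M$1$1" "M$2$3 = M$1$2"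
  shows "derivation g44 (\<lambda>x. M *v x)"
  unfolding derivation_def
  by (simp add: g44_def vec_eq_iff forall_4 sum_4 matrix_vector_mult_def axis_def assms
      algebra_simps)

theorem theorem4p4:
  fixes ip :: "real^4 \<Rightarrow> real^4 \<Rightarrow> real" and R D :: "real^4^4"
  assumes ip: "pseudo_riemannian ip"
    and R: "R = matrix (ricci_operator g44 ip)"
    and "R$2$1 = 0" and "R$3$1 = 0" and "R$4$1 = 0"
    and "R$3$2 = 0" and "R$4$2 = 0" and "R$4$3 = 0"
    and "R$2$3 = R$1$2"
    and "R$3$3 = R$2$2" and "R$2$2 = R$1$1"
    and D: "D = vector
      [vector [R$1$1 - R$4$4, R$1$2,           R$1$3,           R$1$4],
       vector [0,             R$1$1 - R$4$4,   R$1$2,           R$2$4],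
       vector [0,             0,               R$1$1 - R$4$4,   R$3$4],
       vector [0,             0,               0,               0]]"
  shows "algebraic_ricci_soliton g44 ip
    \<and> (\<forall>x. ricci_operator g44 ip x = R$4$4 *\<^sub>R x + D *v x)
    \<and> derivation g44 (\<lambda>x. D *v x)"
proof -
  have br: "bilinear g44" using lie_bracket_g44 by (simp add: lie_bracket_def)
  have "ricci_operator g44 ip x = R *v x" for x
    unfolding R by (simp add: matrix_vector_mul(2)[OF linear_ricci_operator[OF ip br]])
  \<comment> \<open>The last row of \<open>D\<close> is zero, so the (4,4) entry dictates the scalar
    \<open>R$4$4\<close>.\<close>
  moreover have "R *v x = R$4$4 *\<^sub>R x + D *v x" for x
    unfolding D using assms(3-11)
    by (simp add: vec_eq_iff forall_4 sum_4 matrix_vector_mult_def algebra_simps)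
  ultimately have ric: "\<forall>x. ricci_operator g44 ip x = R$4$4 *\<^sub>R x + D *v x" by simp
  have row: "D$4$j = 0" for j
    using exhaust_4[of j] by (auto simp: D)
  have der: "derivation g44 (\<lambda>x. D *v x)"
    by (rule derivation_g44[OF _ _ _ row]) (simp_all add: D)
  show ?thesis
    using ric der unfolding algebraic_ricci_soliton_def by blast
qed

end
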